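(* Let $\Omega\subseteq\mathbb{C}$ be reflection-symmetric, modulus-closed, of pd-type, and such that $I:=\Omega\cap[0,\infty)$ is an interval. Then the following are equivalent for a function $f:\Omega\to\mathbb{C}$: (1) A Hermitian matrix $A\in M_2(\Omega)$ is positive definite if and only if $f[A]$ is positive definite. (2) There exist real $\alpha,\beta>0$ such that: for all $x\in\Omega\cap\mathbb{R}$, $f(x)=\alpha\,\mathrm{sgn}(x)|x|^{\beta}$; and for all $z\in\Omega\setminus\mathbb{R}$, $|f(z)|=\alpha|z|^{\beta}$ and $f(\overline{z})=\overline{f(z)}$. The result holds verbatim with "pd-type" replaced by "psd-type" and "definite" replaced by "semidefinite".
   Context: $M_n(\Omega)$ denotes the set of $n\times n$ matrices with entries in $\Omega$, and $f[A]:=(f(a_{ij}))$ for $A=(a_{ij})$. Positive (semi)definite matrices are Hermitian by definition. $\mathrm{sgn}(0)=0$. A set $\Omega\subseteq\mathbb{C}$ is reflection-symmetric if $z\in\Omega$ implies $\overline{z}\in\Omega$, and modulus-closed if $z\in\Omega$ implies $|z|\in\Omega$. With $I:=\Omega\cap[0,\infty)$, $\Omega$ is of pd-type if for all $z\in\Omega\setminus I$ there exists $\epsilon>0$ such that $|z|+\epsilon\in I$; and of psd-type if for all $z\in\Omega\setminus I$ there exists $\delta>0$ such that $|z|-\delta\in I$.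
   Formalization: The interval I is required not to be a single point; for I={c} the type conditions force Ω={c}, where the claim fails (e.g. Ω={1}, f=-1 in the definite case; Ω={0}, f(0)=1 in the semidefinite case). *)

theory Defs
  imports "HOL-Analysis.Analysis"
begin

definition entries_in :: "complex set \<Rightarrow> complex^'n^'n \<Rightarrow> bool" where
  "entries_in \<Omega> A \<longleftrightarrow> (\<forall>i j. A $ i $ j \<in> \<Omega>)"

definition hermitian_mat :: "complex^'n^'n \<Rightarrow> bool" where
  "hermitian_mat A \<longleftrightarrow> (\<forall>i j. A $ i $ j = cnj (A $ j $ i))"

definition quad_form :: "complex^'n^'n \<Rightarrow> complex^'n \<Rightarrow> complex" where
  "quad_form A v = (\<Sum>i\<in>UNIV. \<Sum>j\<in>UNIV. cnj (v $ i) * A $ i $ j * v $ j)"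

text \<open>The quadratic form of a Hermitian matrix takes real values, so that \<open>Re\<close> loses nothing
  in the next two definitions.\<close>

definition pos_def :: "complex^'n^'n \<Rightarrow> bool" where
  "pos_def A \<longleftrightarrow> hermitian_mat A \<and> (\<forall>v. v \<noteq> 0 \<longrightarrow> 0 < Re (quad_form A v))"

definition pos_semidef :: "complex^'n^'n \<Rightarrow> bool" where
  "pos_semidef A \<longleftrightarrow> hermitian_mat A \<and> (\<forall>v. 0 \<le> Re (quad_form A v))"

definition reflection_symmetric :: "complex set \<Rightarrow> bool" where
  "reflection_symmetric \<Omega> \<longleftrightarrow> (\<forall>z\<in>\<Omega>. cnj z \<in> \<Omega>)"

definition modulus_closed :: "complex set \<Rightarrow> bool" where
  "modulus_closed \<Omega> \<longleftrightarrow> (\<forall>z\<in>\<Omega>. complex_of_real (cmod z) \<in> \<Omega>)"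

definition nonneg_part :: "complex set \<Rightarrow> real set" where
  "nonneg_part \<Omega> = {t. 0 \<le> t \<and> complex_of_real t \<in> \<Omega>}"

definition pd_type :: "complex set \<Rightarrow> bool" where
  "pd_type \<Omega> \<longleftrightarrow>
    (\<forall>z \<in> \<Omega> - complex_of_real ` nonneg_part \<Omega>. \<exists>\<epsilon>>0. cmod z + \<epsilon> \<in> nonneg_part \<Omega>)"

definition psd_type :: "complex set \<Rightarrow> bool" where
  "psd_type \<Omega> \<longleftrightarrow>
    (\<forall>z \<in> \<Omega> - complex_of_real ` nonneg_part \<Omega>. \<exists>\<delta>>0. cmod z - \<delta> \<in> nonneg_part \<Omega>)"

text \<open>A single point does not count as an interval: for \<open>\<Omega> = {1}\<close> the constant function \<open>-1\<close>
  preserves and reflects positive definiteness of 2-by-2 matrices, and so does the constant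
  function \<open>1\<close> on \<open>\<Omega> = {0}\<close> for positive semidefiniteness; neither is of the form
  \<open>power_like\<close> below.\<close>

definition nondegenerate_interval :: "real set \<Rightarrow> bool" where
  "nondegenerate_interval I \<longleftrightarrow> is_interval I \<and> (\<forall>c. I \<noteq> {c})"

definition entrywise :: "(complex \<Rightarrow> complex) \<Rightarrow> complex^'n^'n \<Rightarrow> complex^'n^'n" where
  "entrywise f A = (\<chi> i j. f (A $ i $ j))"

definition power_like :: "complex set \<Rightarrow> (complex \<Rightarrow> complex) \<Rightarrow> bool" where
  "power_like \<Omega> f \<longleftrightarrow>
    (\<exists>\<alpha> \<beta> :: real. \<alpha> > 0 \<and> \<beta> > 0 \<and>
      (\<forall>x :: real. complex_of_real x \<in> \<Omega> \<longrightarrow>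
        f (complex_of_real x) = complex_of_real (\<alpha> * sgn x * \<bar>x\<bar> powr \<beta>)) \<and>
      (\<forall>z \<in> \<Omega> - \<real>. cmod (f z) = \<alpha> * cmod z powr \<beta> \<and> f (cnj z) = cnj (f z)))"

end

theory Submission
  imports Defs
begin

text \<open>
  A matrix with diagonal \<open>a, b\<close> and off-diagonal entries \<open>z, cnj z\<close> is positive definite iff
  \<open>a, b > 0\<close> and \<open>\<bar>z\<bar>\<^sup>2 < ab\<close>. So on the positive part of \<open>\<Omega>\<close> the preservers are those positive \<open>f\<close> for which
  \<open>c\<^sup>2 < ab\<close> and \<open>f(c)\<^sup>2 < f(a) f(b)\<close> are equivalent; in logarithmic coordinates this is a perturbed
  midpoint convexity and concavity at once, and bounded functions with that property are affine.
  Hence \<open>f(x) = \<alpha> x\<^sup>\<beta>\<close> for \<open>x > 0\<close>, and letting \<open>x\<close> tend to \<open>0\<close> gives \<open>f(0) = 0\<close>. Any other \<open>z\<close> is compared with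
  constant diagonals approaching \<open>\<bar>z\<bar>\<close> from above (pd-type) or below (psd-type), which fixes
  \<open>\<bar>f(z)\<bar>\<close>. Finally, \<open>f(x) > 0\<close> for some \<open>x < 0\<close> would make the image of a matrix with the negative
  diagonal entry \<open>x\<close> positive.
\<close>

section \<open>Definiteness of 2-by-2 Hermitian matrices\<close>

lemma hermitian_mat_2:
  fixes A :: "complex^2^2"
  shows "hermitian_mat A \<longleftrightarrow> A$1$1 \<in> \<real> \<and> A$2$2 \<in> \<real> \<and> A$2$1 = cnj (A$1$2)"
  by (auto simp: hermitian_mat_def forall_2 Reals_cnj_iff)

lemma Re_quad_form_2:
  fixes A :: "complex^2^2"
  assumes "hermitian_mat A"
  shows "Re (quad_form A v) = Re (A$1$1) * (cmod (v$1))\<^sup>2 + Re (A$2$2) * (cmod (v$2))\<^sup>2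
    + 2 * Re (cnj (v$1) * A$1$2 * v$2)"
proof -
  have "Im (A$1$1) = 0" "Im (A$2$2) = 0" "A$2$1 = cnj (A$1$2)"
    using assms by (auto simp: hermitian_mat_2 complex_is_Real_iff)
  then show ?thesis
    by (simp add: quad_form_def sum_2 cmod_power2) (simp add: algebra_simps power2_eq_square)
qed

lemma Re_quad_form_2_diag:
  fixes A :: "complex^2^2"
  assumes "hermitian_mat A"
  shows "Re (quad_form A (vector [1, 0])) = Re (A$1$1)"
    and "Re (quad_form A (vector [0, 1])) = Re (A$2$2)"
  using assms by (simp_all add: Re_quad_form_2)

text \<open>For \<open>t\<close> equal to the first diagonal entry, the first row of
  \<open>A\<close> annihilates the test vector, and the value is that entry times the determinant. A
  free \<open>t\<close> also serves the case where that entry vanishes.\<close>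

lemma Re_quad_form_2_kernel:
  fixes A :: "complex^2^2"
  assumes "hermitian_mat A"
  shows "Re (quad_form A (vector [- (A$1$2), of_real t])) =
    Re (A$1$1) * (cmod (A$1$2))\<^sup>2 + t\<^sup>2 * Re (A$2$2) - 2 * t * (cmod (A$1$2))\<^sup>2"
  using assms
  by (simp add: Re_quad_form_2 cmod_power2) (simp add: algebra_simps power2_eq_square)

text \<open>Completing the square in the first coordinate; the factor \<open>Re (A$1$1)\<close>
  avoids a division.\<close>

lemma Re_quad_form_2_square:
  fixes A :: "complex^2^2"
  assumes "hermitian_mat A"
  shows "Re (A$1$1) * Re (quad_form A v) = (cmod (Re (A$1$1) * v$1 + A$1$2 * v$2))\<^sup>2
    + (Re (A$1$1) * Re (A$2$2) - (cmod (A$1$2))\<^sup>2) * (cmod (v$2))\<^sup>2"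
  using assms
  by (simp add: Re_quad_form_2 cmod_power2) (simp add: algebra_simps power2_eq_square)

text \<open>Sylvester's criterion: necessity tests the basis vectors and the kernel vector,
  sufficiency reads the sign off the completed square.\<close>

lemma pos_def_2:
  fixes A :: "complex^2^2"
  shows "pos_def A \<longleftrightarrow> hermitian_mat A \<and> 0 < Re (A$1$1) \<and> 0 < Re (A$2$2) \<and>
    (cmod (A$1$2))\<^sup>2 < Re (A$1$1) * Re (A$2$2)"
    (is "_ \<longleftrightarrow> hermitian_mat A \<and> 0 < ?a \<and> 0 < ?b \<and> ?z < _")
proof (cases "hermitian_mat A")
  case True
  have "0 < ?a \<and> 0 < ?b \<and> ?z < ?a * ?b" if *: "\<And>v. v \<noteq> 0 \<Longrightarrow> 0 < Re (quad_form A v)"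
  proof -
    have a: "0 < ?a" "0 < ?b"
      using *[of "vector [1, 0]"] *[of "vector [0, 1]"] True
      by (auto simp: Re_quad_form_2_diag vec_eq_iff forall_2)
    then have "0 < ?a * ?z + ?a\<^sup>2 * ?b - 2 * ?a * ?z"
      using *[of "vector [- (A$1$2), of_real ?a]"] True
      by (auto simp: Re_quad_form_2_kernel vec_eq_iff forall_2)
    also have "\<dots> = ?a * (?a * ?b - ?z)"
      by (simp add: algebra_simps power2_eq_square)
    finally show ?thesis
      using a by (simp add: zero_less_mult_iff)
  qed
  moreover have "0 < Re (quad_form A v)"
    if "0 < ?a" "?z < ?a * ?b" "v \<noteq> 0" for v
  proof -
    have "v$1 \<noteq> 0 \<or> v$2 \<noteq> 0"
      using that(3) by (auto simp: vec_eq_iff forall_2)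
    then have "0 < ?a * Re (quad_form A v)"
      using that(1,2) by (cases "v$2 = 0") (auto simp: Re_quad_form_2_square[OF True] add_nonneg_pos)
    then show ?thesis
      using that(1) by (simp add: zero_less_mult_iff)
  qed
  ultimately show ?thesis
    using True unfolding pos_def_def by blast
qed (simp add: pos_def_def)

lemma le_of_forall_small:
  fixes u v K d :: real
  assumes "0 < d" and "\<And>e. 0 < e \<Longrightarrow> e \<le> d \<Longrightarrow> u \<le> v + K * e"
  shows "u \<le> v"
proof (rule tendsto_lowerbound)
  show "((\<lambda>e. v + K * e) \<longlongrightarrow> v) (at_right 0)"
    by (auto intro!: tendsto_eq_intros)
  show "\<forall>\<^sub>F e in at_right 0. u \<le> v + K * e"
    using eventually_at_right_real[OF assms(1)] by eventually_elim (use assms(2) in auto)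
qed simp

lemma pos_semidef_2:
  fixes A :: "complex^2^2"
  shows "pos_semidef A \<longleftrightarrow> hermitian_mat A \<and> 0 \<le> Re (A$1$1) \<and> 0 \<le> Re (A$2$2) \<and>
    (cmod (A$1$2))\<^sup>2 \<le> Re (A$1$1) * Re (A$2$2)"
    (is "_ \<longleftrightarrow> hermitian_mat A \<and> 0 \<le> ?a \<and> 0 \<le> ?b \<and> ?z \<le> _")
proof (cases "hermitian_mat A")
  case True
  have "0 \<le> ?a \<and> 0 \<le> ?b \<and> ?z \<le> ?a * ?b" if *: "\<And>v. 0 \<le> Re (quad_form A v)"
  proof -
    have a: "0 \<le> ?a" "0 \<le> ?b"
      using *[of "vector [1, 0]"] *[of "vector [0, 1]"] True
      by (auto simp: Re_quad_form_2_diag)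
    have k: "0 \<le> ?a * ?z + t\<^sup>2 * ?b - 2 * t * ?z" for t
      using *[of "vector [- (A$1$2), of_real t]"] True by (simp add: Re_quad_form_2_kernel)
    have "?z \<le> ?a * ?b"
    proof (cases "?a = 0")
      case True
      \<comment> \<open>With \<open>?a = 0\<close> the form is \<open>t * (?b * t - 2 * ?z)\<close>;
        dividing by \<open>t\<close> and letting it tend to 0 forces \<open>?z = 0\<close>.\<close>
      have "2 * ?z \<le> 0 + ?b * t" if "0 < t" for t
      proof -
        have "0 \<le> t * (?b * t - 2 * ?z)"
          using k[of t] True by (simp add: algebra_simps power2_eq_square)
        then show ?thesis
          using that by (simp add: zero_le_mult_iff)
      qed
      then have "2 * ?z \<le> 0"
        using le_of_forall_small[of 1 "2 * ?z" 0 ?b] by simp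
      then show ?thesis
        using True by simp
    next
      case False
      have "0 \<le> ?a * (?a * ?b - ?z)"
        using k[of ?a] by (simp add: algebra_simps power2_eq_square)
      then show ?thesis
        using a False by (simp add: zero_le_mult_iff)
    qed
    with a show ?thesis by simp
  qed
  moreover have "0 \<le> Re (quad_form A v)"
    if h: "0 \<le> ?a" "0 \<le> ?b" "?z \<le> ?a * ?b" for v
  proof (cases "?a = 0")
    case a: True
    then have "A$1$2 = 0"
      using h by simp
    then show ?thesis
      using a h(2) by (simp add: Re_quad_form_2[OF True])
  next
    case False
    have "0 \<le> ?a * Re (quad_form A v)"
      using h by (auto simp: Re_quad_form_2_square[OF True])
    then show ?thesis
      using h(1) False by (simp add: zero_le_mult_iff)
  qed
  ultimately show ?thesis
    using True unfolding pos_semidef_def by blast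
qed (simp add: pos_semidef_def)

section \<open>Hermitian 2-by-2 matrices parametrised by their diagonal and corner entry\<close>

definition herm2 :: "real \<Rightarrow> complex \<Rightarrow> real \<Rightarrow> complex^2^2" where
  "herm2 a z b = vector [vector [of_real a, z], vector [cnj z, of_real b]]"

lemma herm2_nth [simp]:
  "herm2 a z b $1$1 = of_real a" "herm2 a z b $1$2 = z"
  "herm2 a z b $2$1 = cnj z" "herm2 a z b $2$2 = of_real b"
  by (simp_all add: herm2_def)

lemma hermitian_mat_herm2 [simp]: "hermitian_mat (herm2 a z b)"
  by (simp add: hermitian_mat_2)

lemma hermitian_mat_2_cases:
  assumes "hermitian_mat A"
  obtains a z b where "A = herm2 a z b"
proof
  show "A = herm2 (Re (A$1$1)) (A$1$2) (Re (A$2$2))"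
    using assms by (simp add: hermitian_mat_2 vec_eq_iff forall_2)
qed

text \<open>Reflection symmetry puts the lower left entry \<open>cnj z\<close> into \<Omega>, so the
  three parameters range over \<Omega> independently, with \<open>a\<close> and \<open>b\<close>
  real.\<close>

lemma all_hermitian_mat_2:
  assumes "reflection_symmetric \<Omega>"
  shows "(\<forall>A :: complex^2^2. hermitian_mat A \<and> entries_in \<Omega> A \<longrightarrow> P A) \<longleftrightarrow>
    (\<forall>a b z. of_real a \<in> \<Omega> \<longrightarrow> of_real b \<in> \<Omega> \<longrightarrow> z \<in> \<Omega> \<longrightarrow> P (herm2 a z b))"
proof -
  have "entries_in \<Omega> (herm2 a z b) \<longleftrightarrow> of_real a \<in> \<Omega> \<and> of_real b \<in> \<Omega> \<and> z \<in> \<Omega>" for a z b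
    using assms by (auto simp: entries_in_def reflection_symmetric_def forall_2)
  then show ?thesis
    by (metis hermitian_mat_2_cases hermitian_mat_herm2)
qed

lemma pos_def_herm2: "pos_def (herm2 a z b) \<longleftrightarrow> 0 < a \<and> 0 < b \<and> (cmod z)\<^sup>2 < a * b"
  by (simp add: pos_def_2)

lemma pos_semidef_herm2:
  "pos_semidef (herm2 a z b) \<longleftrightarrow> 0 \<le> a \<and> 0 \<le> b \<and> (cmod z)\<^sup>2 \<le> a * b"
  by (simp add: pos_semidef_2)

text \<open>The image must itself be Hermitian. This is how realness of \<open>f\<close> on the
  diagonal and compatibility with conjugation are obtained later.\<close>

lemma pos_def_entrywise_herm2:
  "pos_def (entrywise f (herm2 a z b)) \<longleftrightarrow>
    f (of_real a) \<in> \<real> \<and> f (of_real b) \<in> \<real> \<and> f (cnj z) = cnj (f z) \<and>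
    0 < Re (f (of_real a)) \<and> 0 < Re (f (of_real b)) \<and>
    (cmod (f z))\<^sup>2 < Re (f (of_real a)) * Re (f (of_real b))"
  by (auto simp: pos_def_2 hermitian_mat_2 entrywise_def)

lemma pos_semidef_entrywise_herm2:
  "pos_semidef (entrywise f (herm2 a z b)) \<longleftrightarrow>
    f (of_real a) \<in> \<real> \<and> f (of_real b) \<in> \<real> \<and> f (cnj z) = cnj (f z) \<and>
    0 \<le> Re (f (of_real a)) \<and> 0 \<le> Re (f (of_real b)) \<and>
    (cmod (f z))\<^sup>2 \<le> Re (f (of_real a)) * Re (f (of_real b))"
  by (auto simp: pos_semidef_2 hermitian_mat_2 entrywise_def)

section \<open>Power laws from midpoint inequalities\<close>

text \<open>Reflecting a point in the nearer endpoint of the interval turns an upper bound \<open>B\<close> for \<open>h\<close>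
  into the upper bound \<open>B / 2\<close>.\<close>

lemma perturbed_midpoint_convex_nonpos:
  fixes h :: "real \<Rightarrow> real"
  assumes h01: "h 0 \<le> 0" "h 1 \<le> 0"
    and bdd: "\<And>x. x \<in> {0..1} \<Longrightarrow> h x \<le> B"
    and mid: "\<And>a b x. \<lbrakk>a \<in> {0..1}; b \<in> {0..1}; x \<in> {0..1}; 2 * x < a + b\<rbrakk>
      \<Longrightarrow> 2 * h x \<le> h a + h b + K * (a + b - 2 * x)"
    and x: "x \<in> {0..1}"
  shows "h x \<le> 0"
proof -
  have half: "h x \<le> M / 2" if M: "0 \<le> M" "\<And>y. y \<in> {0..1} \<Longrightarrow> h y \<le> M" and x: "x \<in> {0..1}" for M x
  proof -
    consider "x < 1/2" | "1/2 \<le> x" "x < 1" | "x = 1"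
      using x by fastforce
    then show ?thesis
    proof cases
      case 1
      \<comment> \<open>The point \<open>x\<close> is the midpoint of \<open>0\<close> and
        \<open>2 * x\<close>; the shift by \<open>e\<close> meets the strict hypothesis of
        \<open>mid\<close> and vanishes in the limit.\<close>
      have "2 * h x \<le> M + K * e" if "0 < e" "e \<le> 1 - 2 * x" for e
      proof -
        have b: "2 * x + e \<in> {0..1}"
          using x that by simp
        have "2 * h x \<le> h 0 + h (2 * x + e) + K * e"
          using mid[OF _ b x, of 0] that by simp
        then show ?thesis
          using M(2)[OF b] h01(1) by linarith
      qed
      then have "2 * h x \<le> M"
        using 1 le_of_forall_small[of "1 - 2 * x" "2 * h x" M K] by auto
      then show ?thesis by simp
    next
      case 2
      have "2 * h x \<le> M + K * e" if "0 < e" "e \<le> 2 - 2 * x" for e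
      proof -
        have b: "2 * x - 1 + e \<in> {0..1}"
          using 2 that by simp
        have "2 * h x \<le> h 1 + h (2 * x - 1 + e) + K * e"
          using mid[OF _ b x, of 1] that by simp
        then show ?thesis
          using M(2)[OF b] h01(2) by linarith
      qed
      then have "2 * h x \<le> M"
        using 2 le_of_forall_small[of "2 - 2 * x" "2 * h x" M K] by auto
      then show ?thesis by simp
    next
      case 3
      then show ?thesis using h01 M by simp
    qed
  qed
  \<comment> \<open>Halving needs a nonnegative bound, because it discards the term
    \<open>h 0\<close> or \<open>h 1\<close>.\<close>
  define M where "M = max B 0"
  have "h y \<le> M / 2 ^ n" if "y \<in> {0..1}" for n y
    using that
  proof (induction n arbitrary: y)
    case 0
    then show ?case using bdd[of y] by (simp add: M_def)
  next
    case (Suc n)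
    then show ?case
      using half[of "M / 2 ^ n" y] by (simp add: M_def mult.commute)
  qed
  then have "\<And>n. h x \<le> M / 2 ^ n" using x by blast
  moreover have "(\<lambda>n. M / 2 ^ n) \<longlonglongrightarrow> 0"
    using LIMSEQ_divide_realpow_zero[of 2 M] by simp
  ultimately show ?thesis
    by (meson LIMSEQ_le_const)
qed

text \<open>Subtract from \<open>g\<close> its chord over the interval from \<open>r\<close> to
  \<open>s\<close>, rescaled to the unit interval: the difference and its negative are both
  nonpositive. Monotonicity supplies boundedness. The cross-multiplied form covers
  \<open>r = s\<close> and can be solved for the value at any of the three points.\<close>

lemma collinear_of_midpoint_inequalities:
  fixes g :: "real \<Rightarrow> real"
  assumes J: "is_interval J"
    and mono: "mono_on J g"
    and above: "\<And>a b c. \<lbrakk>a \<in> J; b \<in> J; c \<in> J; 2 * c < a + b\<rbrakk> \<Longrightarrow> 2 * g c \<le> g a + g b"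
    and below: "\<And>a b c. \<lbrakk>a \<in> J; b \<in> J; c \<in> J; a + b < 2 * c\<rbrakk> \<Longrightarrow> g a + g b \<le> 2 * g c"
    and rs: "r \<in> J" "s \<in> J" "r \<le> x" "x \<le> s"
  shows "(g x - g r) * (s - r) = (x - r) * (g s - g r)"
proof (cases "r = s")
  case True
  then show ?thesis using rs by simp
next
  case False
  then have "r < s" using rs by simp
  define p where "p t = r + t * (s - r)" for t
  define D where "D = g s - g r"
  define h where "h t = g (p t) - g r - t * D" for t
  define y where "y = (x - r) / (s - r)"
  have p: "p t \<in> J" "r \<le> p t" "p t \<le> s" if "t \<in> {0..1}" for t
  proof -
    have "0 \<le> t * (s - r)" "0 \<le> (1 - t) * (s - r)"
      using that \<open>r < s\<close> by auto
    then show "r \<le> p t" "p t \<le> s"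
      by (auto simp: p_def algebra_simps)
    then show "p t \<in> J"
      using J rs by (meson mem_is_interval_1_I)
  qed
  have p01: "p 0 = r" "p 1 = s"
    by (auto simp: p_def)
  have p_less: "2 * p c < p a + p b \<longleftrightarrow> 2 * c < a + b" "p a + p b < 2 * p c \<longleftrightarrow> a + b < 2 * c" for a b c
  proof -
    have "p a + p b - 2 * p c = (a + b - 2 * c) * (s - r)"
      by (simp add: p_def algebra_simps)
    then show "2 * p c < p a + p b \<longleftrightarrow> 2 * c < a + b" "p a + p b < 2 * p c \<longleftrightarrow> a + b < 2 * c"
      using \<open>r < s\<close>
      by (smt (verit) mult_pos_pos mult_less_0_iff mult_neg_pos zero_less_mult_iff)+
  qed
  have y: "y \<in> {0..1}" "p y = x"
    using rs \<open>r < s\<close> by (auto simp: y_def p_def)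
  have g_bounds: "g r \<le> g (p t)" "g (p t) \<le> g s" if "t \<in> {0..1}" for t
    using p[OF that] rs mono by (auto simp: mono_on_def)
  have tD: "0 \<le> t * D" "t * D \<le> D" if "t \<in> {0..1}" for t
    using that g_bounds[of 0] p01 by (auto simp: D_def mult_left_le_one_le)
  \<comment> \<open>The increment \<open>D\<close> serves twice: it bounds \<open>h\<close>, and
    subtracting the chord \<open>t * D\<close> turns \<open>above\<close> into a midpoint inequality
    with defect \<open>D * (a + b - 2 * c)\<close>.\<close>
  have "h y \<le> 0"
  proof (rule perturbed_midpoint_convex_nonpos[where B = D and K = D and h = h])
    show "h t \<le> D" if "t \<in> {0..1}" for t
      using g_bounds[OF that] tD[OF that] by (simp add: h_def D_def)
    show "2 * h c \<le> h a + h b + D * (a + b - 2 * c)"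
      if "a \<in> {0..1}" "b \<in> {0..1}" "c \<in> {0..1}" "2 * c < a + b" for a b c
    proof -
      have "2 * g (p c) \<le> g (p a) + g (p b)"
        using that by (intro above p) (auto simp: p_less)
      then show ?thesis
        by (simp add: h_def algebra_simps)
    qed
  qed (use y p01 in \<open>auto simp: h_def D_def\<close>)
  \<comment> \<open>The reflection of \<open>t\<close> to \<open>1 - t\<close> reverses the strict
    inequality in \<open>below\<close>, which then has the shape required of the negated function;
    it is evaluated at \<open>1 - y\<close>.\<close>
  moreover have "- h (1 - (1 - y)) \<le> 0"
  proof (rule perturbed_midpoint_convex_nonpos[where B = D and K = D and h = "\<lambda>t. - h (1 - t)"])
    show "- h (1 - t) \<le> D" if "t \<in> {0..1}" for t
      using g_bounds[of "1 - t"] tD[of "1 - t"] that by (simp add: h_def D_def)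
    show "2 * - h (1 - c) \<le> - h (1 - a) + - h (1 - b) + D * (a + b - 2 * c)"
      if "a \<in> {0..1}" "b \<in> {0..1}" "c \<in> {0..1}" "2 * c < a + b" for a b c
    proof -
      have "g (p (1 - a)) + g (p (1 - b)) \<le> 2 * g (p (1 - c))"
        using that by (intro below p) (auto simp: p_less)
      then show ?thesis
        by (simp add: h_def algebra_simps)
    qed
  qed (use y p01 in \<open>auto simp: h_def D_def\<close>)
  ultimately have "h y = 0" by simp
  then have "g x - g r = (x - r) / (s - r) * D"
    using y by (simp add: h_def y_def)
  then show ?thesis
    using \<open>r < s\<close> by (simp add: D_def)
qed

text \<open>Passing to \<open>ln (F (exp t))\<close> turns geometric means into midpoints. An affine
  function there is a power law here; its slope is the exponent, positive by strict
  monotonicity.\<close>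

lemma power_law_of_geometric_mean_inequalities:
  fixes F :: "real \<Rightarrow> real"
  assumes I: "is_interval I" "I \<subseteq> {0<..}" "p \<in> I" "q \<in> I" "p < q"
    and pos: "\<And>x. x \<in> I \<Longrightarrow> 0 < F x"
    and mono: "strict_mono_on I F"
    and above: "\<And>a b c. \<lbrakk>a \<in> I; b \<in> I; c \<in> I; c\<^sup>2 < a * b\<rbrakk> \<Longrightarrow> (F c)\<^sup>2 \<le> F a * F b"
    and below: "\<And>a b c. \<lbrakk>a \<in> I; b \<in> I; c \<in> I; a * b < c\<^sup>2\<rbrakk> \<Longrightarrow> F a * F b \<le> (F c)\<^sup>2"
  obtains \<alpha> \<beta> :: real where "0 < \<alpha>" "0 < \<beta>" "\<And>x. x \<in> I \<Longrightarrow> F x = \<alpha> * x powr \<beta>"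
proof -
  define J where "J = {t. exp t \<in> I}"
  define g where "g t = ln (F (exp t))" for t
  have exp_g: "exp (g t) = F (exp t)" if "t \<in> J" for t
    using pos that by (simp add: g_def J_def)
  have J: "is_interval J"
    unfolding is_interval_1 J_def
    using mem_is_interval_1_I[OF I(1)] by (metis exp_le_cancel_iff mem_Collect_eq)
  have P: "ln p \<in> J" "ln q \<in> J" "ln p < ln q"
    using I by (auto simp: J_def)
  have exp_less: "(exp c)\<^sup>2 < exp a * exp b \<longleftrightarrow> 2 * c < a + b"
    "exp a * exp b < (exp c)\<^sup>2 \<longleftrightarrow> a + b < 2 * c"
    "(exp c)\<^sup>2 \<le> exp a * exp b \<longleftrightarrow> 2 * c \<le> a + b"
    "exp a * exp b \<le> (exp c)\<^sup>2 \<longleftrightarrow> a + b \<le> 2 * c" for a b c :: real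
    by (simp_all flip: exp_add exp_double)
  have gmono: "strict_mono_on J g"
  proof (rule strict_mono_onI)
    fix a b assume "a \<in> J" "b \<in> J" "a < b"
    then have "exp (g a) < exp (g b)"
      using mono by (auto simp: exp_g J_def strict_mono_on_def)
    then show "g a < g b" by simp
  qed
  have g1: "2 * g c \<le> g a + g b" if "a \<in> J" "b \<in> J" "c \<in> J" "2 * c < a + b" for a b c
    using above[of "exp a" "exp b" "exp c"] that
    by (simp add: exp_less J_def flip: exp_g)
  have g2: "g a + g b \<le> 2 * g c" if "a \<in> J" "b \<in> J" "c \<in> J" "a + b < 2 * c" for a b c
    using below[of "exp a" "exp b" "exp c"] that
    by (simp add: exp_less J_def flip: exp_g)
  note col = collinear_of_midpoint_inequalities[OF J strict_mono_on_imp_mono_on[OF gmono] g1 g2]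
  define \<beta> where "\<beta> = (g (ln q) - g (ln p)) / (ln q - ln p)"
  define \<alpha> where "\<alpha> = exp (g (ln p) - \<beta> * ln p)"
  have line: "g t = g (ln p) + (t - ln p) * \<beta>" if "t \<in> J" for t
  proof -
    \<comment> \<open>Collinearity is known only for a point between two others, so the cases say
      which of the three points is in the middle.\<close>
    consider "t \<le> ln p" | "ln p \<le> t" "t \<le> ln q" | "ln q \<le> t" by linarith
    then have "(g t - g (ln p)) * (ln q - ln p) = (t - ln p) * (g (ln q) - g (ln p))"
    proof cases
      case 1
      then show ?thesis
        using col[of t "ln q" "ln p"] P that by (simp add: algebra_simps)
    next
      case 2
      then show ?thesis
        using col[of "ln p" "ln q" t] P that by simp
    next
      case 3
      then show ?thesis
        using col[of "ln p" t "ln q"] P that by (simp add: algebra_simps)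
    qed
    then show ?thesis
      using P(3) by (simp add: \<beta>_def field_simps)
  qed
  show thesis
  proof
    show "0 < \<alpha>" by (simp add: \<alpha>_def)
    show "0 < \<beta>"
      using P gmono by (simp add: \<beta>_def strict_mono_on_def)
    show "F x = \<alpha> * x powr \<beta>" if "x \<in> I" for x
    proof -
      have x: "0 < x" "ln x \<in> J"
        using that I by (auto simp: J_def)
      then have "F x = exp (g (ln x))"
        by (simp add: exp_g)
      also have "\<dots> = \<alpha> * x powr \<beta>"
        using x by (simp add: line \<alpha>_def powr_def algebra_simps flip: exp_add)
      finally show ?thesis .
    qed
  qed
qed

section \<open>Power functions preserve and reflect definiteness\<close>

lemma powr_less_iff_base:
  fixes x y \<beta> :: real
  assumes "0 \<le> x" "0 \<le> y" "0 < \<beta>"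
  shows "x powr \<beta> < y powr \<beta> \<longleftrightarrow> x < y"
  using assms powr_less_mono2[of \<beta> x y] powr_mono2[of \<beta> y x] by linarith

text \<open>Powers are multiplicative on nonnegative reals, so both sides are \<alpha> squared times
  the \<beta>-th powers of \<open>r * r\<close> and \<open>a * b\<close>.\<close>

lemma square_powr_less_iff:
  fixes a b r :: real
  assumes "0 < \<alpha>" "0 < \<beta>" "0 \<le> a" "0 \<le> b" "0 \<le> r"
  shows "(\<alpha> * r powr \<beta>)\<^sup>2 < \<alpha> * a powr \<beta> * (\<alpha> * b powr \<beta>) \<longleftrightarrow> r\<^sup>2 < a * b"
proof -
  have "(\<alpha> * r powr \<beta>)\<^sup>2 < \<alpha> * a powr \<beta> * (\<alpha> * b powr \<beta>) \<longleftrightarrow>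
      \<alpha>\<^sup>2 * (r\<^sup>2) powr \<beta> < \<alpha>\<^sup>2 * (a * b) powr \<beta>"
    using assms by (simp add: power2_eq_square powr_mult algebra_simps)
  also have "\<dots> \<longleftrightarrow> r\<^sup>2 < a * b"
    using assms by (simp add: powr_less_iff_base)
  finally show ?thesis .
qed

lemma square_powr_le_iff:
  fixes a b r :: real
  assumes "0 < \<alpha>" "0 < \<beta>" "0 \<le> a" "0 \<le> b" "0 \<le> r"
  shows "(\<alpha> * r powr \<beta>)\<^sup>2 \<le> \<alpha> * a powr \<beta> * (\<alpha> * b powr \<beta>) \<longleftrightarrow> r\<^sup>2 \<le> a * b"
proof -
  have "(\<alpha> * r powr \<beta>)\<^sup>2 \<le> \<alpha> * a powr \<beta> * (\<alpha> * b powr \<beta>) \<longleftrightarrow>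
      \<alpha>\<^sup>2 * (r\<^sup>2) powr \<beta> \<le> \<alpha>\<^sup>2 * (a * b) powr \<beta>"
    using assms by (simp add: power2_eq_square powr_mult algebra_simps)
  also have "\<dots> \<longleftrightarrow> r\<^sup>2 \<le> a * b"
    using assms powr_less_iff_base[of "a * b" "r\<^sup>2" \<beta>] by (simp add: linorder_not_less[symmetric] mult_less_0_iff)
  finally show ?thesis .
qed

text \<open>On the real points the modulus and conjugation conditions follow from the explicit
  formula, at 0 because \<open>sgn 0\<close> and \<open>0 powr \<beta>\<close> both vanish. They
  thus hold on all of \<Omega>.\<close>

lemma power_likeE:
  assumes "power_like \<Omega> f"
  obtains \<alpha> \<beta> :: real where "0 < \<alpha>" "0 < \<beta>"
    and "\<And>x. of_real x \<in> \<Omega> \<Longrightarrow> f (of_real x) = of_real (\<alpha> * sgn x * \<bar>x\<bar> powr \<beta>)"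
    and "\<And>z. z \<in> \<Omega> \<Longrightarrow> cmod (f z) = \<alpha> * cmod z powr \<beta>"
    and "\<And>z. z \<in> \<Omega> \<Longrightarrow> f (cnj z) = cnj (f z)"
proof -
  obtain \<alpha> \<beta> :: real where \<alpha>\<beta>: "0 < \<alpha>" "0 < \<beta>"
    and real: "\<And>x. of_real x \<in> \<Omega> \<Longrightarrow> f (of_real x) = of_real (\<alpha> * sgn x * \<bar>x\<bar> powr \<beta>)"
    and nonreal: "\<And>z. z \<in> \<Omega> - \<real> \<Longrightarrow> cmod (f z) = \<alpha> * cmod z powr \<beta> \<and> f (cnj z) = cnj (f z)"
    using assms unfolding power_like_def by blast
  have "cmod (f z) = \<alpha> * cmod z powr \<beta> \<and> f (cnj z) = cnj (f z)" if z: "z \<in> \<Omega>" for z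
  proof (cases "z \<in> \<real>")
    case True
    then obtain x where x: "z = of_real x"
      by (auto elim: Reals_cases)
    have "0 \<le> \<alpha> * \<bar>x\<bar> powr \<beta>"
      using \<alpha>\<beta> by simp
    then show ?thesis
      using real[of x] z unfolding x
      by (cases x "0 :: real" rule: linorder_cases) (auto simp flip: of_real_mult)
  next
    case False
    then show ?thesis using nonreal z by blast
  qed
  then show thesis
    using that \<alpha>\<beta> real by blast
qed

text \<open>At real points \<open>f\<close> has the sign of its argument, so the diagonal conditions
  agree; for positive diagonals the determinant conditions agree too.\<close>

lemma power_like_pos_def_iff:
  assumes "power_like \<Omega> f" "of_real a \<in> \<Omega>" "of_real b \<in> \<Omega>" "z \<in> \<Omega>"
  shows "pos_def (herm2 a z b) \<longleftrightarrow> pos_def (entrywise f (herm2 a z b))"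
proof -
  obtain \<alpha> \<beta> :: real where \<alpha>\<beta>: "0 < \<alpha>" "0 < \<beta>"
    and real: "\<And>x. of_real x \<in> \<Omega> \<Longrightarrow> f (of_real x) = of_real (\<alpha> * sgn x * \<bar>x\<bar> powr \<beta>)"
    and norm: "\<And>z. z \<in> \<Omega> \<Longrightarrow> cmod (f z) = \<alpha> * cmod z powr \<beta>"
    and cnj: "\<And>z. z \<in> \<Omega> \<Longrightarrow> f (cnj z) = cnj (f z)"
    using power_likeE[OF assms(1)] by blast
  have pos: "0 < Re (f (of_real x)) \<longleftrightarrow> 0 < x" if "of_real x \<in> \<Omega>" for x
    using real[OF that] \<alpha>\<beta> by (cases x "0 :: real" rule: linorder_cases) (auto simp: mult_less_0_iff)
  have "(cmod (f z))\<^sup>2 < Re (f (of_real a)) * Re (f (of_real b)) \<longleftrightarrow> (cmod z)\<^sup>2 < a * b"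
    if "0 < a" "0 < b"
    using square_powr_less_iff[OF \<alpha>\<beta>, of a b "cmod z"] that by (simp add: real norm assms)
  moreover have "f (of_real a) \<in> \<real>" "f (of_real b) \<in> \<real>"
    using real[OF assms(2)] real[OF assms(3)] by auto
  ultimately show ?thesis
    unfolding pos_def_herm2 pos_def_entrywise_herm2 using pos assms cnj by auto
qed

lemma power_like_pos_semidef_iff:
  assumes "power_like \<Omega> f" "of_real a \<in> \<Omega>" "of_real b \<in> \<Omega>" "z \<in> \<Omega>"
  shows "pos_semidef (herm2 a z b) \<longleftrightarrow> pos_semidef (entrywise f (herm2 a z b))"
proof -
  obtain \<alpha> \<beta> :: real where \<alpha>\<beta>: "0 < \<alpha>" "0 < \<beta>"
    and real: "\<And>x. of_real x \<in> \<Omega> \<Longrightarrow> f (of_real x) = of_real (\<alpha> * sgn x * \<bar>x\<bar> powr \<beta>)"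
    and norm: "\<And>z. z \<in> \<Omega> \<Longrightarrow> cmod (f z) = \<alpha> * cmod z powr \<beta>"
    and cnj: "\<And>z. z \<in> \<Omega> \<Longrightarrow> f (cnj z) = cnj (f z)"
    using power_likeE[OF assms(1)] by blast
  have nonneg: "0 \<le> Re (f (of_real x)) \<longleftrightarrow> 0 \<le> x" if "of_real x \<in> \<Omega>" for x
    using real[OF that] \<alpha>\<beta> by (cases x "0 :: real" rule: linorder_cases) (auto simp: mult_le_0_iff)
  have Re_f: "Re (f (of_real x)) = \<alpha> * x powr \<beta>" if "of_real x \<in> \<Omega>" "0 \<le> x" for x
    using real[OF that(1)] that(2) by (cases "x = 0") auto
  have "(cmod (f z))\<^sup>2 \<le> Re (f (of_real a)) * Re (f (of_real b)) \<longleftrightarrow> (cmod z)\<^sup>2 \<le> a * b"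
    if "0 \<le> a" "0 \<le> b"
    using square_powr_le_iff[OF \<alpha>\<beta>, of a b "cmod z"] that by (simp add: Re_f norm assms)
  moreover have "f (of_real a) \<in> \<real>" "f (of_real b) \<in> \<real>"
    using real[OF assms(2)] real[OF assms(3)] by auto
  ultimately show ?thesis
    unfolding pos_semidef_herm2 pos_semidef_entrywise_herm2 using nonneg assms cnj by auto
qed

section \<open>Definiteness preservers are power functions\<close>

lemma nonneg_partD:
  assumes "x \<in> nonneg_part \<Omega>"
  shows "0 \<le> x" "of_real x \<in> \<Omega>"
  using assms by (auto simp: nonneg_part_def)

lemma nondegenerate_intervalE:
  assumes "nondegenerate_interval I" "I \<noteq> {}"
  obtains p q where "p \<in> I" "q \<in> I" "p < q"
proof -
  obtain p where "p \<in> I" using assms(2) by blast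
  then obtain q where "q \<in> I" "q \<noteq> p"
    using assms(1) by (auto simp: nondegenerate_interval_def)
  then show thesis
    using that \<open>p \<in> I\<close> by (cases p q rule: linorder_cases) auto
qed

text \<open>The common core of both characterisations: weak conclusions from strict comparisons hold
  for either kind of preserver. The modulus at \<open>c\<close> allows \<open>c = 0\<close>, where
  \<open>f\<close> is not assumed real.\<close>

lemma power_law_on_nonneg_part:
  assumes I: "nondegenerate_interval (nonneg_part \<Omega>)" "nonneg_part \<Omega> \<noteq> {}"
    and real: "\<And>x. \<lbrakk>x \<in> nonneg_part \<Omega>; 0 < x\<rbrakk> \<Longrightarrow> f (of_real x) \<in> \<real> \<and> 0 < Re (f (of_real x))"
    and mono: "\<And>x y. \<lbrakk>x \<in> nonneg_part \<Omega>; y \<in> nonneg_part \<Omega>; 0 < x; x < y\<rbrakk>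
      \<Longrightarrow> Re (f (of_real x)) < Re (f (of_real y))"
    and above: "\<And>a b c. \<lbrakk>a \<in> nonneg_part \<Omega>; b \<in> nonneg_part \<Omega>; c \<in> nonneg_part \<Omega>;
      0 < a; 0 < b; c\<^sup>2 < a * b\<rbrakk>
      \<Longrightarrow> (cmod (f (of_real c)))\<^sup>2 \<le> Re (f (of_real a)) * Re (f (of_real b))"
    and below: "\<And>a b c. \<lbrakk>a \<in> nonneg_part \<Omega>; b \<in> nonneg_part \<Omega>; c \<in> nonneg_part \<Omega>;
      0 < a; 0 < b; a * b < c\<^sup>2\<rbrakk>
      \<Longrightarrow> Re (f (of_real a)) * Re (f (of_real b)) \<le> (cmod (f (of_real c)))\<^sup>2"
  obtains \<alpha> \<beta> :: real where "0 < \<alpha>" "0 < \<beta>"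
    "\<And>x. x \<in> nonneg_part \<Omega> \<Longrightarrow> f (of_real x) = of_real (\<alpha> * x powr \<beta>)"
proof -
  define I where "I = nonneg_part \<Omega>"
  define F where "F x = Re (f (of_real x))" for x
  have f_F: "f (of_real x) = of_real (F x)" "0 < F x" if "x \<in> I" "0 < x" for x
    using real[of x] that by (auto simp: F_def I_def)
  have interval: "is_interval I"
    using I(1) by (simp add: nondegenerate_interval_def I_def)
  obtain p q where pq: "p \<in> I" "q \<in> I" "p < q"
    using nondegenerate_intervalE[OF I] unfolding I_def .
  have "0 \<le> p" using nonneg_partD(1)[of p \<Omega>] pq(1) by (simp add: I_def)
  \<comment> \<open>Since \<open>p\<close> may be 0, the midpoint of \<open>p\<close> and
    \<open>q\<close> replaces it as a positive base point.\<close>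
  obtain \<alpha> \<beta> :: real where \<alpha>\<beta>: "0 < \<alpha>" "0 < \<beta>"
    and F: "\<And>x. x \<in> I \<inter> {0<..} \<Longrightarrow> F x = \<alpha> * x powr \<beta>"
  proof (rule power_law_of_geometric_mean_inequalities[of "I \<inter> {0<..}" "(p + q) / 2" q F])
    show "is_interval (I \<inter> {0<..})"
      using interval by (intro is_interval_Int is_interval_oi)
    show "(p + q) / 2 \<in> I \<inter> {0<..}"
      using mem_is_interval_1_I[OF interval pq(1,2), of "(p + q) / 2"] pq \<open>0 \<le> p\<close> by auto
    show "strict_mono_on (I \<inter> {0<..}) F"
      using mono by (auto simp: strict_mono_on_def F_def I_def)
    show "(F c)\<^sup>2 \<le> F a * F b"
      if "a \<in> I \<inter> {0<..}" "b \<in> I \<inter> {0<..}" "c \<in> I \<inter> {0<..}" "c\<^sup>2 < a * b" for a b c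
      using above[of a b c] that by (auto simp: f_F simp flip: I_def)
    show "F a * F b \<le> (F c)\<^sup>2"
      if "a \<in> I \<inter> {0<..}" "b \<in> I \<inter> {0<..}" "c \<in> I \<inter> {0<..}" "a * b < c\<^sup>2" for a b c
      using below[of a b c] that by (auto simp: f_F simp flip: I_def)
  qed (use pq \<open>0 \<le> p\<close> f_F in auto)
  have "f 0 = 0" if "0 \<in> I"
  proof -
    \<comment> \<open>Apply \<open>above\<close> to the diagonal \<open>x, x\<close> with
      \<open>c = 0\<close> and let \<open>x\<close> tend to 0.\<close>
    have "(cmod (f 0))\<^sup>2 \<le> 0"
    proof (rule tendsto_lowerbound)
      have "((\<lambda>x :: real. (\<alpha> * x powr \<beta>)\<^sup>2) \<longlongrightarrow> (\<alpha> * 0 powr \<beta>)\<^sup>2) (at_right 0)"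
        using \<open>0 < \<beta>\<close> by (intro tendsto_intros tendsto_powr')
          (auto simp: eventually_at_right_less eventually_at_filter)
      then show "((\<lambda>x. (\<alpha> * x powr \<beta>)\<^sup>2) \<longlongrightarrow> 0) (at_right 0)"
        by simp
      have "0 < q" using \<open>0 \<le> p\<close> pq(3) by simp
      show "\<forall>\<^sub>F x in at_right 0. (cmod (f 0))\<^sup>2 \<le> (\<alpha> * x powr \<beta>)\<^sup>2"
        using eventually_at_right_real[OF \<open>0 < q\<close>]
      proof eventually_elim
        case (elim x)
        then have x: "x \<in> I" "0 < x"
          using mem_is_interval_1_I[OF interval that pq(2), of x] by auto
        then show ?case
          using above[of x x 0] that F[of x] by (simp add: power2_eq_square flip: I_def F_def)
      qed
    qed simp
    then show ?thesis by simp
  qed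
  then have "f (of_real x) = of_real (\<alpha> * x powr \<beta>)" if "x \<in> nonneg_part \<Omega>" for x
    using F[of x] f_F(1)[of x] that nonneg_partD(1)[OF that] by (cases "x = 0") (auto simp: I_def)
  then show thesis
    using that \<alpha>\<beta> by blast
qed

text \<open>A negative real point equals its conjugate, so \<open>f\<close> is real there and the
  modulus leaves two candidates; \<open>neg\<close> rules out the positive one.\<close>

lemma power_likeI:
  assumes "0 < \<alpha>" "0 < \<beta>"
    and nonneg: "\<And>x. x \<in> nonneg_part \<Omega> \<Longrightarrow> f (of_real x) = of_real (\<alpha> * x powr \<beta>)"
    and other: "\<And>z. z \<in> \<Omega> - of_real ` nonneg_part \<Omega> \<Longrightarrow>
      cmod (f z) = \<alpha> * cmod z powr \<beta> \<and> f (cnj z) = cnj (f z)"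
    and neg: "\<And>x. \<lbrakk>x < 0; of_real x \<in> \<Omega>\<rbrakk> \<Longrightarrow> f (of_real x) \<noteq> of_real (\<alpha> * \<bar>x\<bar> powr \<beta>)"
  shows "power_like \<Omega> f"
  unfolding power_like_def
proof (intro exI conjI allI impI ballI)
  show "f (of_real x) = of_real (\<alpha> * sgn x * \<bar>x\<bar> powr \<beta>)" if x: "of_real x \<in> \<Omega>" for x
  proof (cases "0 \<le> x")
    case True
    then show ?thesis
      using nonneg[of x] x by (auto simp: nonneg_part_def sgn_real_def)
  next
    case False
    then have *: "of_real x \<in> \<Omega> - of_real ` nonneg_part \<Omega>"
      using x by (auto simp: nonneg_part_def)
    have "f (of_real x) \<in> \<real>"
      using other[OF *] by (simp add: Reals_cnj_iff)
    then obtain y where y: "f (of_real x) = of_real y"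
      by (auto elim: Reals_cases)
    have "\<bar>y\<bar> = \<alpha> * \<bar>x\<bar> powr \<beta>" "y \<noteq> \<alpha> * \<bar>x\<bar> powr \<beta>"
      using other[OF *] neg[of x] False x y by auto
    then have "y = - (\<alpha> * \<bar>x\<bar> powr \<beta>)" by linarith
    then show ?thesis using False y by simp
  qed
  show "cmod (f z) = \<alpha> * cmod z powr \<beta>" "f (cnj z) = cnj (f z)" if "z \<in> \<Omega> - \<real>" for z
    using other[of z] that Reals_of_real by blast+
qed fact+

lemma mem_nonneg_part_cmod:
  assumes "modulus_closed \<Omega>" "z \<in> \<Omega>"
  shows "cmod z \<in> nonneg_part \<Omega>"
  using assms by (simp add: modulus_closed_def nonneg_part_def)

text \<open>The values \<open>c = 1\<close> and \<open>c = - 1\<close> serve the approach to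
  \<open>r\<close> from above and from below.\<close>

lemma tendsto_scaled_powr:
  fixes r :: real
  assumes "0 < r"
  shows "((\<lambda>e. \<alpha> * (r + c * e) powr \<beta>) \<longlongrightarrow> \<alpha> * r powr \<beta>) (at_right 0)"
proof -
  have "((\<lambda>e. \<alpha> * (r + c * e) powr \<beta>) \<longlongrightarrow> \<alpha> * (r + c * 0) powr \<beta>) (at_right 0)"
    using assms by (intro tendsto_intros) auto
  then show ?thesis by simp
qed

lemma power_like_of_pos_def_iff:
  assumes \<Omega>: "modulus_closed \<Omega>" "nondegenerate_interval (nonneg_part \<Omega>)" "pd_type \<Omega>"
    and H: "\<And>a b z. \<lbrakk>of_real a \<in> \<Omega>; of_real b \<in> \<Omega>; z \<in> \<Omega>\<rbrakk>
      \<Longrightarrow> pos_def (herm2 a z b) \<longleftrightarrow> pos_def (entrywise f (herm2 a z b))"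
  shows "power_like \<Omega> f"
proof (cases "nonneg_part \<Omega> = {}")
  case True
  then have "\<Omega> = {}"
    using mem_nonneg_part_cmod[OF \<Omega>(1)] by blast
  then show ?thesis
    unfolding power_like_def by (intro exI[of _ 1]) auto
next
  case False
  define I where "I = nonneg_part \<Omega>"
  define F where "F x = Re (f (of_real x))" for x
  note ID = nonneg_partD[of _ \<Omega>, folded I_def]
  have interval: "is_interval I"
    using \<Omega>(2) by (simp add: nondegenerate_interval_def I_def)
  have pd: "f (of_real a) \<in> \<real> \<and> 0 < F a \<and> 0 < F b \<and> f (cnj z) = cnj (f z) \<and> (cmod (f z))\<^sup>2 < F a * F b"
    if "a \<in> I" "b \<in> I" "z \<in> \<Omega>" "0 < a" "0 < b" "(cmod z)\<^sup>2 < a * b" for a b z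
    using H[of a b z] that ID unfolding pos_def_herm2 pos_def_entrywise_herm2 F_def by blast
  obtain p q where pq: "p \<in> I" "q \<in> I" "p < q"
    using nondegenerate_intervalE[OF \<Omega>(2) False] unfolding I_def .
  \<comment> \<open>The determinant must be strictly positive, so a second point \<open>y\<close> of
    \<open>I\<close> is needed: as the corner entry if smaller than \<open>x\<close>, as a diagonal
    entry if larger.\<close>
  have pos: "f (of_real x) \<in> \<real> \<and> 0 < F x" if x: "x \<in> I" "0 < x" for x
  proof -
    obtain y where "y \<in> I" "y \<noteq> x"
      using pq by (metis less_irrefl)
    then consider "y < x" | "x < y" by linarith
    then show ?thesis
    proof cases
      case 1
      then show ?thesis
        using pd[of x x "of_real y"] x \<open>y \<in> I\<close> ID[of y] by (simp add: power2_eq_square mult_strict_mono)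
    next
      case 2
      then show ?thesis
        using pd[of x y "of_real x"] x \<open>y \<in> I\<close> ID[of x] by (simp add: power2_eq_square)
    qed
  qed
  have f_F: "f (of_real x) = of_real (F x)" if "x \<in> I" "0 < x" for x
    using pos[OF that] by (simp add: F_def)
  \<comment> \<open>With positive diagonals and a Hermitian image only the determinants remain to
    compare, so failure of the inequality transfers as well.\<close>
  have iff: "(cmod z)\<^sup>2 < a * b \<longleftrightarrow> (cmod (f z))\<^sup>2 < F a * F b"
    if "a \<in> I" "b \<in> I" "z \<in> \<Omega>" "0 < a" "0 < b" "f (cnj z) = cnj (f z)" for a b z
    using H[of a b z] that ID pos unfolding pos_def_herm2 pos_def_entrywise_herm2 F_def by blast
  obtain \<alpha> \<beta> :: real where \<alpha>\<beta>: "0 < \<alpha>" "0 < \<beta>"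
    and f: "\<And>x. x \<in> I \<Longrightarrow> f (of_real x) = of_real (\<alpha> * x powr \<beta>)"
  proof (rule power_law_on_nonneg_part[of \<Omega> f, OF \<Omega>(2) False, folded I_def F_def])
    show "f (of_real x) \<in> \<real> \<and> 0 < F x" if "x \<in> I" "0 < x" for x
      using pos that by blast
    show "F x < F y" if "x \<in> I" "y \<in> I" "0 < x" "x < y" for x y
    proof -
      have "x\<^sup>2 < y * y"
        using that by (simp add: power2_eq_square mult_strict_mono)
      then have "(F x)\<^sup>2 < (F y)\<^sup>2"
        using pd[of y y "of_real x"] that ID[of x] f_F[of x] by (simp add: power2_eq_square)
      then show ?thesis
        using pos[of y] that by (meson less_imp_le power_less_imp_less_base less_trans)
    qed
    show "(cmod (f (of_real c)))\<^sup>2 \<le> F a * F b"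
      if "a \<in> I" "b \<in> I" "c \<in> I" "0 < a" "0 < b" "c\<^sup>2 < a * b" for a b c
      using pd[of a b "of_real c"] that ID[of c] by simp
    show "F a * F b \<le> (cmod (f (of_real c)))\<^sup>2"
      if "a \<in> I" "b \<in> I" "c \<in> I" "0 < a" "0 < b" "a * b < c\<^sup>2" for a b c
    proof -
      have "0 < c"
        using ID(1)[OF that(3)] that by (cases "c = 0") (auto simp: mult_less_0_iff)
      then show ?thesis
        using iff[of a b "of_real c"] that ID[of c] f_F[of c] by simp
    qed
  qed blast
  have F: "F x = \<alpha> * x powr \<beta>" if "x \<in> I" for x
    using f[OF that] by (simp add: F_def)
  \<comment> \<open>The pd-type condition gives a single point above \<open>cmod z\<close>; the
    interval property fills the gap.\<close>
  have other: "0 < cmod z \<and> (\<exists>\<epsilon>>0. \<forall>e. 0 \<le> e \<longrightarrow> e \<le> \<epsilon> \<longrightarrow> cmod z + e \<in> I)"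
    if z: "z \<in> \<Omega> - of_real ` I" for z
  proof -
    have r: "cmod z \<in> I"
      using mem_nonneg_part_cmod[OF \<Omega>(1)] z by (simp add: I_def)
    then have "z \<noteq> 0"
      using z by force
    moreover obtain \<epsilon> where "\<epsilon> > 0" "cmod z + \<epsilon> \<in> I"
      using \<Omega>(3) z unfolding pd_type_def I_def by blast
    ultimately show ?thesis
      using mem_is_interval_1_I[OF interval r] by force
  qed
  show ?thesis
  proof (rule power_likeI[OF \<alpha>\<beta>, of \<Omega> f, folded I_def])
    show "cmod (f z) = \<alpha> * cmod z powr \<beta> \<and> f (cnj z) = cnj (f z)"
      if z: "z \<in> \<Omega> - of_real ` I" for z
    proof -
      obtain \<epsilon> where \<epsilon>: "\<epsilon> > 0" "\<And>e. \<lbrakk>0 \<le> e; e \<le> \<epsilon>\<rbrakk> \<Longrightarrow> cmod z + e \<in> I" and r: "0 < cmod z"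
        using other[OF z] by blast
      have *: "f (cnj z) = cnj (f z) \<and> cmod (f z) \<le> \<alpha> * (cmod z + 1 * e) powr \<beta>" if "0 < e" "e \<le> \<epsilon>" for e
      proof -
        have "(cmod z)\<^sup>2 < (cmod z + e) * (cmod z + e)"
          unfolding power2_eq_square using that r by (intro mult_strict_mono) (simp_all del: zero_less_norm_iff)
        then have "f (cnj z) = cnj (f z) \<and> (cmod (f z))\<^sup>2 < (F (cmod z + e))\<^sup>2 \<and> 0 < F (cmod z + e)"
          using pd[of "cmod z + e" "cmod z + e" z] \<epsilon>(2)[of e] that r z by (simp add: power2_eq_square)
        then show ?thesis
          using F[OF \<epsilon>(2)[of e]] that power_less_imp_less_base[of "cmod (f z)" 2] by force
      qed
      have cnj: "f (cnj z) = cnj (f z)"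
        using *[of \<epsilon>] \<epsilon>(1) by simp
      have "cmod (f z) \<le> \<alpha> * cmod z powr \<beta>"
      proof (rule tendsto_lowerbound[OF tendsto_scaled_powr[OF r, of \<alpha> 1 \<beta>]])
        show "\<forall>\<^sub>F e in at_right 0. cmod (f z) \<le> \<alpha> * (cmod z + 1 * e) powr \<beta>"
          using eventually_at_right_real[OF \<epsilon>(1)] by eventually_elim (use * in auto)
      qed simp
      \<comment> \<open>The matrix with both diagonal entries \<open>cmod z\<close> is singular,
        hence not positive definite, and neither is its image.\<close>
      moreover have "(\<alpha> * cmod z powr \<beta>)\<^sup>2 \<le> (cmod (f z))\<^sup>2"
        using iff[of "cmod z" "cmod z" z] F[of "cmod z"] \<epsilon>(2)[of 0] \<epsilon>(1) r z cnj
        by (simp add: power2_eq_square)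
      ultimately show ?thesis
        using cnj power2_le_imp_le[OF _ norm_ge_zero] by (meson antisym)
    qed
    show "f (of_real x) \<noteq> of_real (\<alpha> * \<bar>x\<bar> powr \<beta>)" if x: "x < 0" "of_real x \<in> \<Omega>" for x
    proof
      assume fx: "f (of_real x) = of_real (\<alpha> * \<bar>x\<bar> powr \<beta>)"
      have "of_real x \<in> \<Omega> - of_real ` I"
        using x ID by force
      then obtain \<epsilon> where \<epsilon>: "\<epsilon> > 0" "\<And>e. \<lbrakk>0 \<le> e; e \<le> \<epsilon>\<rbrakk> \<Longrightarrow> \<bar>x\<bar> + e \<in> I"
        using other[of "of_real x"] by auto
      have I: "\<bar>x\<bar> \<in> I" "\<bar>x\<bar> + \<epsilon> \<in> I"
        using \<epsilon>(2)[of 0] \<epsilon>(2)[of \<epsilon>] \<epsilon>(1) by auto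
      \<comment> \<open>Replacing the diagonal entry \<open>\<bar>x\<bar>\<close> by
        \<open>x\<close> does not change the image, as \<open>f\<close> agrees at both; the summand
        \<epsilon> makes the determinant positive before the replacement.\<close>
      have "\<bar>x\<bar> * \<bar>x\<bar> < \<bar>x\<bar> * (\<bar>x\<bar> + \<epsilon>)"
        using x \<epsilon>(1) by (intro mult_strict_left_mono) auto
      then have "(cmod (f (of_real \<bar>x\<bar>)))\<^sup>2 < F \<bar>x\<bar> * F (\<bar>x\<bar> + \<epsilon>)"
        using iff[of "\<bar>x\<bar>" "\<bar>x\<bar> + \<epsilon>" "of_real \<bar>x\<bar>"] I ID[OF I(1)] f_F[OF I(1)] x \<epsilon>(1)
        by (simp add: power2_eq_square)
      then have "pos_def (entrywise f (herm2 x (of_real \<bar>x\<bar>) (\<bar>x\<bar> + \<epsilon>)))"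
        unfolding pos_def_entrywise_herm2
        using fx f[OF I(1)] f[OF I(2)] F[OF I(1)] F[OF I(2)] \<alpha>\<beta> \<epsilon>(1) x by simp
      then have "pos_def (herm2 x (of_real \<bar>x\<bar>) (\<bar>x\<bar> + \<epsilon>))"
        using H x ID I by blast
      then show False
        using x by (simp add: pos_def_herm2)
    qed
  qed (use f in auto)
qed

text \<open>Singular matrices are now admissible, so the diagonal \<open>cmod z, cmod z\<close>
  gives the upper bound on \<open>cmod (f z)\<close> at once, while the lower bound needs the limit,
  through smaller diagonals whose matrices are not semidefinite.\<close>

lemma power_like_of_pos_semidef_iff:
  assumes \<Omega>: "modulus_closed \<Omega>" "nondegenerate_interval (nonneg_part \<Omega>)" "psd_type \<Omega>"
    and H: "\<And>a b z. \<lbrakk>of_real a \<in> \<Omega>; of_real b \<in> \<Omega>; z \<in> \<Omega>\<rbrakk>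
      \<Longrightarrow> pos_semidef (herm2 a z b) \<longleftrightarrow> pos_semidef (entrywise f (herm2 a z b))"
  shows "power_like \<Omega> f"
proof (cases "nonneg_part \<Omega> = {}")
  case True
  then have "\<Omega> = {}"
    using mem_nonneg_part_cmod[OF \<Omega>(1)] by blast
  then show ?thesis
    unfolding power_like_def by (intro exI[of _ 1]) auto
next
  case False
  define I where "I = nonneg_part \<Omega>"
  define F where "F x = Re (f (of_real x))" for x
  note ID = nonneg_partD[of _ \<Omega>, folded I_def]
  have interval: "is_interval I"
    using \<Omega>(2) by (simp add: nondegenerate_interval_def I_def)
  have psd: "f (of_real a) \<in> \<real> \<and> 0 \<le> F a \<and> f (cnj z) = cnj (f z) \<and> (cmod (f z))\<^sup>2 \<le> F a * F b"
    if "a \<in> I" "b \<in> I" "z \<in> \<Omega>" "(cmod z)\<^sup>2 \<le> a * b" for a b z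
    using H[of a b z] that ID unfolding pos_semidef_herm2 pos_semidef_entrywise_herm2 F_def by blast
  have nonneg: "f (of_real x) \<in> \<real> \<and> 0 \<le> F x" if "x \<in> I" for x
    using psd[of x x "of_real x"] that ID[OF that] by (simp add: power2_eq_square)
  have f_F: "f (of_real x) = of_real (F x)" if "x \<in> I" for x
    using nonneg[OF that] by (simp add: F_def)
  have iff: "(cmod z)\<^sup>2 \<le> a * b \<longleftrightarrow> (cmod (f z))\<^sup>2 \<le> F a * F b"
    if "a \<in> I" "b \<in> I" "z \<in> \<Omega>" "f (cnj z) = cnj (f z)" for a b z
    using H[of a b z] that ID nonneg unfolding pos_semidef_herm2 pos_semidef_entrywise_herm2 F_def
    by blast
  have iff_real: "c\<^sup>2 \<le> a * b \<longleftrightarrow> (F c)\<^sup>2 \<le> F a * F b"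
    if "a \<in> I" "b \<in> I" "c \<in> I" for a b c
    using iff[of a b "of_real c"] that f_F[of c] ID[of c] by simp
  have mono: "F x < F y" if "x \<in> I" "y \<in> I" "x < y" for x y
  proof -
    have "\<not> y\<^sup>2 \<le> x * x"
      using that ID(1)[OF that(1)] by (simp add: power2_eq_square not_le mult_strict_mono)
    then have "(F x)\<^sup>2 < (F y)\<^sup>2"
      using iff_real[of x x y] that by (simp add: power2_eq_square)
    then show ?thesis
      using nonneg that by (meson power_less_imp_less_base)
  qed
  obtain p q where pq: "p \<in> I" "q \<in> I" "p < q"
    using nondegenerate_intervalE[OF \<Omega>(2) False] unfolding I_def .
  have pos: "0 < F x" if x: "x \<in> I" "0 < x" for x
  proof -
    obtain y where y: "y \<in> I" "y \<noteq> x"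
      using pq by (metis less_irrefl)
    then consider "y < x" | "x < y" by linarith
    then show ?thesis
    proof cases
      case 1
      then show ?thesis
        using mono[of y x] nonneg[of y] x y by simp
    next
      case 2
      \<comment> \<open>If \<open>x\<close> is the least point of \<open>I\<close>, monotonicity
        gives only \<open>0 \<le> F x\<close>. The singular matrix with diagonal \<open>x, y\<close>
        and corner \<open>c\<close> helps: \<open>F c\<close> exceeds \<open>F x\<close>, so it is
        positive and makes \<open>F x * F y\<close> positive.\<close>
      define c where "c = sqrt (x * y)"
      have c: "x < c" "c < y" "c\<^sup>2 = x * y"
        using x 2 by (auto simp: c_def power2_eq_square intro!: real_less_rsqrt real_less_lsqrt)
      then have "c \<in> I"
        using mem_is_interval_1_I[OF interval x(1) y(1), of c] by simp
      then have "(F c)\<^sup>2 \<le> F x * F y" "0 < F c"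
        using iff_real[of x y c] mono[of x c] nonneg[of x] x y c by auto
      then have "0 < F x * F y"
        by (smt (verit) zero_less_power)
      then show ?thesis
        using nonneg[of x] x by (auto simp: zero_less_mult_iff)
    qed
  qed
  obtain \<alpha> \<beta> :: real where \<alpha>\<beta>: "0 < \<alpha>" "0 < \<beta>"
    and f: "\<And>x. x \<in> I \<Longrightarrow> f (of_real x) = of_real (\<alpha> * x powr \<beta>)"
  proof (rule power_law_on_nonneg_part[of \<Omega> f, OF \<Omega>(2) False, folded I_def F_def])
    show "f (of_real x) \<in> \<real> \<and> 0 < F x" if "x \<in> I" "0 < x" for x
      using pos nonneg that by blast
    show "F x < F y" if "x \<in> I" "y \<in> I" "0 < x" "x < y" for x y
      using mono that by blast
    show "(cmod (f (of_real c)))\<^sup>2 \<le> F a * F b"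
      if "a \<in> I" "b \<in> I" "c \<in> I" "0 < a" "0 < b" "c\<^sup>2 < a * b" for a b c
      using iff_real[of a b c] f_F[of c] that by simp
    show "F a * F b \<le> (cmod (f (of_real c)))\<^sup>2"
      if "a \<in> I" "b \<in> I" "c \<in> I" "0 < a" "0 < b" "a * b < c\<^sup>2" for a b c
      using iff_real[of a b c] f_F[of c] that by simp
  qed blast
  have F: "F x = \<alpha> * x powr \<beta>" if "x \<in> I" for x
    using f[OF that] by (simp add: F_def)
  have other: "cmod z \<in> I \<and> (\<exists>\<delta>>0. \<delta> \<le> cmod z \<and> (\<forall>d. 0 \<le> d \<longrightarrow> d \<le> \<delta> \<longrightarrow> cmod z - d \<in> I))"
    if z: "z \<in> \<Omega> - of_real ` I" for z
  proof -
    have r: "cmod z \<in> I"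
      using mem_nonneg_part_cmod[OF \<Omega>(1)] z by (simp add: I_def)
    obtain \<delta> where \<delta>: "\<delta> > 0" "cmod z - \<delta> \<in> I"
      using \<Omega>(3) z unfolding psd_type_def I_def by blast
    moreover have "\<delta> \<le> cmod z"
      using ID(1)[OF \<delta>(2)] by simp
    ultimately show ?thesis
      using r mem_is_interval_1_I[OF interval \<delta>(2) r] by force
  qed
  show ?thesis
  proof (rule power_likeI[OF \<alpha>\<beta>, of \<Omega> f, folded I_def])
    show "cmod (f z) = \<alpha> * cmod z powr \<beta> \<and> f (cnj z) = cnj (f z)"
      if z: "z \<in> \<Omega> - of_real ` I" for z
    proof -
      obtain \<delta> where \<delta>: "\<delta> > 0" "\<delta> \<le> cmod z" "\<And>d. \<lbrakk>0 \<le> d; d \<le> \<delta>\<rbrakk> \<Longrightarrow> cmod z - d \<in> I"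
        and r: "cmod z \<in> I"
        using other[OF z] by blast
      have cnj: "f (cnj z) = cnj (f z)" and "(cmod (f z))\<^sup>2 \<le> (\<alpha> * cmod z powr \<beta>)\<^sup>2"
        using psd[of "cmod z" "cmod z" z] r z F[OF r] by (auto simp: power2_eq_square)
      then have "cmod (f z) \<le> \<alpha> * cmod z powr \<beta>"
        using \<alpha>\<beta> power2_le_imp_le by fastforce
      moreover have "\<alpha> * cmod z powr \<beta> \<le> cmod (f z)"
      proof (rule tendsto_upperbound[OF tendsto_scaled_powr[of "cmod z" \<alpha> "- 1" \<beta>]])
        have "\<alpha> * (cmod z + - 1 * d) powr \<beta> \<le> cmod (f z)" if d: "0 < d" "d \<le> \<delta>" for d
        proof -
          have "\<not> (cmod z)\<^sup>2 \<le> (cmod z - d) * (cmod z - d)"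
            unfolding power2_eq_square not_le
            using d \<delta>(2) by (intro mult_strict_mono) auto
          then have "(F (cmod z - d))\<^sup>2 \<le> (cmod (f z))\<^sup>2"
            using iff[of "cmod z - d" "cmod z - d" z] \<delta>(3)[of d] d z cnj
            by (simp add: power2_eq_square)
          then show ?thesis
            using F[OF \<delta>(3)[of d]] d power2_le_imp_le[OF _ norm_ge_zero] by simp
        qed
        then show "\<forall>\<^sub>F d in at_right 0. \<alpha> * (cmod z + - 1 * d) powr \<beta> \<le> cmod (f z)"
          using eventually_at_right_real[OF \<delta>(1)] by (auto elim: eventually_mono)
      qed (use \<delta> in auto)
      ultimately show ?thesis
        using cnj by simp
    qed
    show "f (of_real x) \<noteq> of_real (\<alpha> * \<bar>x\<bar> powr \<beta>)" if x: "x < 0" "of_real x \<in> \<Omega>" for x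
    proof
      assume fx: "f (of_real x) = of_real (\<alpha> * \<bar>x\<bar> powr \<beta>)"
      have "of_real x \<in> \<Omega> - of_real ` I"
        using x ID by force
      then have I: "\<bar>x\<bar> \<in> I"
        using other[of "of_real x"] by auto
      \<comment> \<open>All four entries of the image of
        \<open>herm2 x (of_real \<bar>x\<bar>) \<bar>x\<bar>\<close> then equal the same nonnegative
        number, so the image is semidefinite although \<open>x\<close> is negative.\<close>
      from fx have "f (of_real x) = of_real (F \<bar>x\<bar>)"
        by (simp add: F[OF I])
      then have "pos_semidef (entrywise f (herm2 x (of_real \<bar>x\<bar>) \<bar>x\<bar>))"
        unfolding pos_semidef_entrywise_herm2
        using f_F[OF I] nonneg[OF I] by (simp add: power2_eq_square)
      then have "pos_semidef (herm2 x (of_real \<bar>x\<bar>) \<bar>x\<bar>)"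
        using H x ID I by blast
      then show False
        using x by (simp add: pos_semidef_herm2)
    qed
  qed (use f in auto)
qed

theorem theorem1:
  fixes \<Omega> :: "complex set" and f :: "complex \<Rightarrow> complex"
  assumes "reflection_symmetric \<Omega>"
    and "modulus_closed \<Omega>"
    and "nondegenerate_interval (nonneg_part \<Omega>)"
  shows "(pd_type \<Omega> \<longrightarrow>
           ((\<forall>A :: complex^2^2. hermitian_mat A \<and> entries_in \<Omega> A \<longrightarrow>
               (pos_def A \<longleftrightarrow> pos_def (entrywise f A)))
            \<longleftrightarrow> power_like \<Omega> f)) \<and>
         (psd_type \<Omega> \<longrightarrow>
           ((\<forall>A :: complex^2^2. hermitian_mat A \<and> entries_in \<Omega> A \<longrightarrow>
               (pos_semidef A \<longleftrightarrow> pos_semidef (entrywise f A)))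
            \<longleftrightarrow> power_like \<Omega> f))"
  unfolding all_hermitian_mat_2[OF assms(1)]
  using power_like_of_pos_def_iff[OF assms(2,3)] power_like_pos_def_iff
    power_like_of_pos_semidef_iff[OF assms(2,3)] power_like_pos_semidef_iff
  by blast

end
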